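(* Let $G=(V,E,p)$ be a finite connected graph, let $n\in(1,\infty)$ and $\kappa\in\mathbb{R}\setminus\{0\}$, and suppose $f:V\to\mathbb{C}$ is a (nonzero) eigenfunction of $-\Delta$ with eigenvalue $\lambda>0$, i.e. $-\Delta f=\lambda f$, such that $f$ satisfies $CD(n,\kappa)$. Then for every $x\in V$ $$|\nabla f|^2(x)\le\left(\left(8-\frac2n\right)\lambda-4\kappa\right)\max_{z\in V}|f(z)|^2.$$
   Context: Graphs: $G=(V,E,p)$ has a finite vertex set $V$, a set $E$ of undirected edges with no loops and no multiple edges, and a nonnegative symmetric edge weight $p_{xy}=p_{yx}$ for each edge $\{x,y\}$. Write $x\sim y$ for adjacency. The degree is $d_x=\sum_{y\sim x}p_{xy}$, and $d_x>0$ for every $x\in V$. For functions $f,g:V\to\mathbb{C}$: $$(\Delta f)(x)=\frac1{d_x}\sum_{y\sim x}p_{xy}(f(y)-f(x)),\qquad 2\Gamma(f,g)=\Delta(f\overline g)-f\,\overline{\Delta g}-(\Delta f)\overline g,$$ $$2\Gamma_2(f,g)=\Delta\Gamma(f,g)-\Gamma(f,\Delta g)-\Gamma(\Delta f,g),$$ $$|\nabla f|^2(x)=2\Gamma(f,f)(x)=\frac1{d_x}\sum_{y\sim x}p_{xy}|f(y)-f(x)|^2.$$ A single function $f$ satisfies $CD(n,\kappa)$ if $\Gamma_2(f,f)\ge\frac1n|\Delta f|^2+\kappa\,\Gamma(f,f)$ at every vertex of $G$. *)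

theory Defs
  imports Complex_Main
begin

(* Edges are two-element subsets of V, so there are neither loops nor multiple edges.
   A weight may vanish on an edge; only the degrees have to be positive.
   Values of p off the edges are irrelevant. *)

definition nbrs :: "'a set set \<Rightarrow> 'a \<Rightarrow> 'a set" where
  "nbrs E x = {y. {x, y} \<in> E}"

definition wdegree :: "'a set set \<Rightarrow> ('a \<Rightarrow> 'a \<Rightarrow> real) \<Rightarrow> 'a \<Rightarrow> real" where
  "wdegree E p x = (\<Sum>y\<in>nbrs E x. p x y)"

locale weighted_graph =
  fixes V :: "'a set" and E :: "'a set set" and p :: "'a \<Rightarrow> 'a \<Rightarrow> real"
  assumes finite_V: "finite V"
    and edges: "e \<in> E \<Longrightarrow> e \<subseteq> V \<and> card e = 2"
    and weight_nonneg: "{x, y} \<in> E \<Longrightarrow> 0 \<le> p x y"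
    and weight_sym: "{x, y} \<in> E \<Longrightarrow> p x y = p y x"
    and degree_pos: "x \<in> V \<Longrightarrow> 0 < wdegree E p x"

definition connected_graph :: "'a set \<Rightarrow> 'a set set \<Rightarrow> bool" where
  "connected_graph V E \<longleftrightarrow> (\<forall>x\<in>V. \<forall>y\<in>V. (x, y) \<in> {(u, v). {u, v} \<in> E}\<^sup>*)"

definition laplacian ::
  "'a set set \<Rightarrow> ('a \<Rightarrow> 'a \<Rightarrow> real) \<Rightarrow> ('a \<Rightarrow> complex) \<Rightarrow> 'a \<Rightarrow> complex" where
  "laplacian E p f x =
     1 / of_real (wdegree E p x) * (\<Sum>y\<in>nbrs E x. of_real (p x y) * (f y - f x))"

(* Gamma: linear in the first argument, conjugate linear in the second. *)
definition carre_du_champ ::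
  "'a set set \<Rightarrow> ('a \<Rightarrow> 'a \<Rightarrow> real) \<Rightarrow> ('a \<Rightarrow> complex) \<Rightarrow> ('a \<Rightarrow> complex) \<Rightarrow> 'a \<Rightarrow> complex" where
  "carre_du_champ E p f g x =
     (laplacian E p (\<lambda>z. f z * cnj (g z)) x
        - f x * cnj (laplacian E p g x) - laplacian E p f x * cnj (g x)) / 2"

(* Gamma_2: the iterate of Gamma. *)
definition iterated_carre_du_champ ::
  "'a set set \<Rightarrow> ('a \<Rightarrow> 'a \<Rightarrow> real) \<Rightarrow> ('a \<Rightarrow> complex) \<Rightarrow> ('a \<Rightarrow> complex) \<Rightarrow> 'a \<Rightarrow> complex" where
  "iterated_carre_du_champ E p f g x =
     (laplacian E p (carre_du_champ E p f g) x
        - carre_du_champ E p f (laplacian E p g) x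
        - carre_du_champ E p (laplacian E p f) g x) / 2"

definition grad_sq ::
  "'a set set \<Rightarrow> ('a \<Rightarrow> 'a \<Rightarrow> real) \<Rightarrow> ('a \<Rightarrow> complex) \<Rightarrow> 'a \<Rightarrow> real" where
  "grad_sq E p f x = 1 / wdegree E p x * (\<Sum>y\<in>nbrs E x. p x y * (cmod (f y - f x))\<^sup>2)"

(* Both Gamma (f, f) and Gamma_2 (f, f) are real valued (lemmas below), so that taking real
   parts merely turns them into elements of an ordered type. *)
definition satisfies_CD ::
  "'a set \<Rightarrow> 'a set set \<Rightarrow> ('a \<Rightarrow> 'a \<Rightarrow> real) \<Rightarrow> real \<Rightarrow> real \<Rightarrow> ('a \<Rightarrow> complex) \<Rightarrow> bool" where
  "satisfies_CD V E p n \<kappa> f \<longleftrightarrow>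
     (\<forall>x\<in>V. Re (iterated_carre_du_champ E p f f x)
        \<ge> 1 / n * (cmod (laplacian E p f x))\<^sup>2 + \<kappa> * Re (carre_du_champ E p f f x))"

definition eigenfunction ::
  "'a set \<Rightarrow> 'a set set \<Rightarrow> ('a \<Rightarrow> 'a \<Rightarrow> real) \<Rightarrow> real \<Rightarrow> ('a \<Rightarrow> complex) \<Rightarrow> bool" where
  "eigenfunction V E p \<mu> f \<longleftrightarrow>
     (\<exists>x\<in>V. f x \<noteq> 0) \<and> (\<forall>x\<in>V. - laplacian E p f x = of_real \<mu> * f x)"

lemma cnj_laplacian: "cnj (laplacian E p f x) = laplacian E p (\<lambda>z. cnj (f z)) x"
  by (simp add: laplacian_def cnj_sum)

lemma cnj_carre_du_champ: "cnj (carre_du_champ E p f g x) = carre_du_champ E p g f x"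
  by (simp add: carre_du_champ_def cnj_laplacian mult.commute)

lemma Im_iterated_carre_du_champ: "Im (iterated_carre_du_champ E p f f x) = 0"
proof -
  have "cnj (iterated_carre_du_champ E p f f x) = iterated_carre_du_champ E p f f x"
    by (simp add: iterated_carre_du_champ_def cnj_laplacian cnj_carre_du_champ)
  then show ?thesis
    by (metis Reals_cnj_iff complex_is_Real_iff)
qed

lemma grad_sq_eq:
  "of_real (grad_sq E p f x) = 2 * carre_du_champ E p f f x"
proof -
  define c where "c = 1 / complex_of_real (wdegree E p x)"
  have L: "laplacian E p g x = (\<Sum>y\<in>nbrs E x. c * of_real (p x y) * (g y - g x))" for g
    by (simp add: laplacian_def c_def sum_distrib_left mult.assoc)
  have cc: "cnj c = c"
    by (simp add: c_def)
  have "2 * carre_du_champ E p f f x =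
      (\<Sum>y\<in>nbrs E x. c * of_real (p x y) * ((f y - f x) * cnj (f y - f x)))"
    unfolding carre_du_champ_def L
    by (simp add: cnj_sum cc sum_distrib_left sum_distrib_right flip: sum_subtractf)
       (intro sum.cong refl, simp add: algebra_simps)
  also have "\<dots> = of_real (grad_sq E p f x)"
    unfolding grad_sq_def c_def
    by (simp add: sum_distrib_left complex_norm_square mult.assoc del: of_real_power flip: of_real_power)
  finally show ?thesis by simp
qed

end

theory Submission
  imports Defs
begin

text \<open>The proof is a maximum principle argument. Write \<open>F = |\<nabla>f|\<^sup>2\<close> and \<open>-\<Delta>f = \<mu> f\<close>.
  Since \<open>\<Gamma>(f, \<Delta>f) = -\<mu> \<Gamma>(f, f)\<close>, the curvature-dimension inequality becomes a lower bound for
  \<open>\<Delta>F\<close>, while the definition of \<open>\<Gamma>\<close> gives an exact formula for \<open>\<Delta>|f|\<^sup>2\<close>: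
  \<open>\<Delta>F \<ge> 4\<mu>\<^sup>2/n |f|\<^sup>2 + 2(\<kappa> - \<mu>) F\<close> and \<open>\<Delta>|f|\<^sup>2 = F - 2\<mu> |f|\<^sup>2\<close>.
  For real \<open>\<alpha>\<close> let \<open>x0\<close> maximise \<open>F + \<alpha>|f|\<^sup>2\<close> over \<open>V\<close>. The Laplacian of this function is not positive
  at \<open>x0\<close>, hence \<open>(\<alpha> + 2\<kappa> - 2\<mu>) F \<le> (2\<alpha>\<mu> - 4\<mu>\<^sup>2/n) |f|\<^sup>2\<close> at \<open>x0\<close>
  (lemma \<open>gradient_estimate_at_maximum\<close>). This is used for two values of \<open>\<alpha>\<close>.

  For \<open>\<alpha> = 0\<close> it yields \<open>\<kappa> \<le> \<mu>\<close>: otherwise \<open>F\<close> would vanish identically, which is impossible for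
  \<open>\<mu> \<noteq> 0\<close> (lemmas \<open>eigenfunction_grad_sq_pos\<close> and \<open>CD_eigenvalue_ge_curvature\<close>).

  For \<open>\<alpha> = 4\<mu> - 2\<kappa>\<close>, which is positive by the previous step, division by \<open>2\<mu>\<close> gives
  \<open>F(x0) \<le> (\<alpha> - 2\<mu>/n) |f(x0)|\<^sup>2\<close>, so that for every vertex \<open>x\<close>
  \<open>F(x) \<le> F(x) + \<alpha>|f(x)|\<^sup>2 \<le> F(x0) + \<alpha>|f(x0)|\<^sup>2 \<le> (2\<alpha> - 2\<mu>/n) |f(x0)|\<^sup>2\<close>.
  The constant \<open>2\<alpha> - 2\<mu>/n\<close> is the one of the theorem. It is positive, because \<open>F\<close> is positive
  somewhere, and therefore \<open>|f(x0)|\<^sup>2\<close> may be replaced by the maximum of \<open>|f|\<^sup>2\<close>.\<close>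

lemma laplacian_add:
  "laplacian E p (\<lambda>z. f z + g z) x = laplacian E p f x + laplacian E p g x"
  unfolding laplacian_def distrib_left[symmetric] sum.distrib[symmetric]
  by (simp add: algebra_simps)

lemma laplacian_cmult:
  "laplacian E p (\<lambda>z. c * f z) x = c * laplacian E p f x"
  unfolding laplacian_def
  by (simp add: sum_distrib_left algebra_simps)

lemma carre_du_champ_cmult_left:
  "carre_du_champ E p (\<lambda>z. c * f z) g x = c * carre_du_champ E p f g x"
  unfolding carre_du_champ_def
  by (simp add: laplacian_cmult mult.assoc right_diff_distrib)

lemma carre_du_champ_cmult_right:
  "carre_du_champ E p f (\<lambda>z. c * g z) x = cnj c * carre_du_champ E p f g x"
  using carre_du_champ_cmult_left[of E p c g f x]
  by (metis cnj_carre_du_champ complex_cnj_mult)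

context weighted_graph
begin

lemma nbrs_subset: "nbrs E x \<subseteq> V"
  using edges by (auto simp: nbrs_def)

lemma finite_nbrs: "finite (nbrs E x)"
  using nbrs_subset finite_V by (rule finite_subset)

text \<open>The eigenvalue equation holds on \<open>V\<close> only, so replacing \<open>\<Delta>f\<close> by \<open>-\<mu> f\<close> inside another operator
  relies on these operators seeing only values on \<open>V\<close>.\<close>

lemma laplacian_cong:
  assumes "x \<in> V" "\<And>z. z \<in> V \<Longrightarrow> f z = g z"
  shows "laplacian E p f x = laplacian E p g x"
  unfolding laplacian_def using assms nbrs_subset[of x]
  by (intro arg_cong2[where f = "(*)"] sum.cong) auto

lemma carre_du_champ_cong:
  assumes "x \<in> V" "\<And>z. z \<in> V \<Longrightarrow> f z = f' z" "\<And>z. z \<in> V \<Longrightarrow> g z = g' z"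
  shows "carre_du_champ E p f g x = carre_du_champ E p f' g' x"
proof -
  have "laplacian E p (\<lambda>z. f z * cnj (g z)) x = laplacian E p (\<lambda>z. f' z * cnj (g' z)) x"
    using assms by (intro laplacian_cong) auto
  moreover have "laplacian E p f x = laplacian E p f' x" "laplacian E p g x = laplacian E p g' x"
    using assms by (auto intro: laplacian_cong)
  ultimately show ?thesis
    using assms by (simp add: carre_du_champ_def)
qed

lemma laplacian_nonpos_at_maximum:
  assumes "x \<in> V" "\<And>z. z \<in> V \<Longrightarrow> Re (h z) \<le> Re (h x)"
  shows "Re (laplacian E p h x) \<le> 0"
proof -
  have "(\<Sum>y\<in>nbrs E x. p x y * (Re (h y) - Re (h x))) \<le> 0"
    using assms nbrs_subset[of x] weight_nonneg
    by (intro sum_nonpos mult_nonneg_nonpos) (auto simp: nbrs_def)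
  moreover have "Re (laplacian E p h x) =
      1 / wdegree E p x * (\<Sum>y\<in>nbrs E x. p x y * (Re (h y) - Re (h x)))"
  proof -
    have "laplacian E p h x = of_real (1 / wdegree E p x) * (\<Sum>y\<in>nbrs E x. of_real (p x y) * (h y - h x))"
      by (simp add: laplacian_def)
    then show ?thesis
      by (simp del: of_real_divide)
  qed
  ultimately show ?thesis
    using degree_pos[OF assms(1)] by (simp add: mult_nonneg_nonpos divide_nonpos_pos)
qed

lemma grad_sq_nonneg:
  assumes "x \<in> V"
  shows "0 \<le> grad_sq E p f x"
  unfolding grad_sq_def using weight_nonneg degree_pos[OF assms]
  by (intro mult_nonneg_nonneg sum_nonneg) (auto simp: nbrs_def)

text \<open>A weight may be zero on an edge, so a vanishing gradient at \<open>x\<close> does not force \<open>f\<close> to be constant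
  on the neighbourhood of \<open>x\<close>; still each term of \<open>\<Delta>f(x)\<close> vanishes.\<close>

lemma laplacian_eq_0_if_grad_sq_eq_0:
  assumes "x \<in> V" "grad_sq E p f x = 0"
  shows "laplacian E p f x = 0"
proof -
  have "(\<Sum>y\<in>nbrs E x. p x y * (cmod (f y - f x))\<^sup>2) = 0"
    using assms degree_pos[OF assms(1)] by (auto simp: grad_sq_def)
  then have "\<forall>y\<in>nbrs E x. p x y * (cmod (f y - f x))\<^sup>2 = 0"
    using weight_nonneg
    by (subst (asm) sum_nonneg_eq_0_iff[OF finite_nbrs]) (auto simp: nbrs_def)
  then have "(\<Sum>y\<in>nbrs E x. of_real (p x y) * (f y - f x)) = 0"
    by (intro sum.neutral) auto
  then show ?thesis by (simp add: laplacian_def)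
qed

lemma eigenfunction_laplacian:
  assumes "eigenfunction V E p \<mu> f" "x \<in> V"
  shows "laplacian E p f x = - of_real \<mu> * f x"
  using assms by (metis eigenfunction_def minus_minus mult_minus_left)

lemma eigenfunction_grad_sq_pos:
  assumes "eigenfunction V E p \<mu> f" "\<mu> \<noteq> 0"
  obtains x where "x \<in> V" "0 < grad_sq E p f x"
proof -
  obtain x where x: "x \<in> V" "f x \<noteq> 0"
    using assms by (auto simp: eigenfunction_def)
  then have "grad_sq E p f x \<noteq> 0"
    using laplacian_eq_0_if_grad_sq_eq_0[OF x(1), of f] eigenfunction_laplacian[OF assms(1) x(1)]
      assms(2) by auto
  then show thesis
    using that x grad_sq_nonneg[OF x(1), of f] by force
qed

lemma laplacian_cmod_sq_eigenfunction:
  assumes "eigenfunction V E p \<mu> f" "x \<in> V"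
  shows "Re (laplacian E p (\<lambda>z. f z * cnj (f z)) x) = grad_sq E p f x - 2 * \<mu> * (cmod (f x))\<^sup>2"
proof -
  have "laplacian E p (\<lambda>z. f z * cnj (f z)) x =
      of_real (grad_sq E p f x) - of_real (2 * \<mu>) * (f x * cnj (f x))"
    unfolding grad_sq_eq carre_du_champ_def
    using eigenfunction_laplacian[OF assms] by (simp add: algebra_simps)
  also have "f x * cnj (f x) = of_real ((cmod (f x))\<^sup>2)"
    by (rule complex_norm_square[symmetric])
  finally show ?thesis
    by simp
qed

text \<open>The identity \<open>2\<Gamma>\<^sub>2(f, f) = \<Delta>\<Gamma>(f, f) + 2\<mu> \<Gamma>(f, f)\<close> for eigenfunctions turns the
  curvature-dimension inequality into a differential inequality for the gradient.\<close>

lemma laplacian_grad_sq_eigenfunction: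
  assumes ef: "eigenfunction V E p \<mu> f" and CD: "satisfies_CD V E p n \<kappa> f" and x: "x \<in> V"
  shows "4 * \<mu>\<^sup>2 / n * (cmod (f x))\<^sup>2 + 2 * (\<kappa> - \<mu>) * grad_sq E p f x
    \<le> Re (laplacian E p (\<lambda>z. 2 * carre_du_champ E p f f z) x)"
proof -
  have "carre_du_champ E p (laplacian E p f) f x = carre_du_champ E p (\<lambda>z. - of_real \<mu> * f z) f x"
    using x eigenfunction_laplacian[OF ef] by (intro carre_du_champ_cong) auto
  then have left: "carre_du_champ E p (laplacian E p f) f x = - of_real \<mu> * carre_du_champ E p f f x"
    by (simp only: carre_du_champ_cmult_left)
  have "carre_du_champ E p f (laplacian E p f) x = carre_du_champ E p f (\<lambda>z. - of_real \<mu> * f z) x"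
    using x eigenfunction_laplacian[OF ef] by (intro carre_du_champ_cong) auto
  then have right: "carre_du_champ E p f (laplacian E p f) x = - of_real \<mu> * carre_du_champ E p f f x"
    by (simp only: carre_du_champ_cmult_right) simp
  have "2 * iterated_carre_du_champ E p f f x =
      laplacian E p (carre_du_champ E p f f) x + of_real (2 * \<mu>) * carre_du_champ E p f f x"
    unfolding iterated_carre_du_champ_def left right by simp
  then have "Re (2 * iterated_carre_du_champ E p f f x) =
      Re (laplacian E p (carre_du_champ E p f f) x + of_real (2 * \<mu>) * carre_du_champ E p f f x)"
    by (rule arg_cong)
  then have bochner: "2 * Re (iterated_carre_du_champ E p f f x) =
      Re (laplacian E p (carre_du_champ E p f f) x) + 2 * \<mu> * Re (carre_du_champ E p f f x)"
    by simp
  have cmod_laplacian: "(cmod (laplacian E p f x))\<^sup>2 = \<mu>\<^sup>2 * (cmod (f x))\<^sup>2"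
    by (simp add: eigenfunction_laplacian[OF ef x] norm_mult power_mult_distrib)
  have "\<mu>\<^sup>2 / n * (cmod (f x))\<^sup>2 + \<kappa> * Re (carre_du_champ E p f f x)
      \<le> Re (iterated_carre_du_champ E p f f x)"
    using bspec[OF CD[unfolded satisfies_CD_def] x] unfolding cmod_laplacian by simp
  moreover have "grad_sq E p f x = 2 * Re (carre_du_champ E p f f x)"
    using arg_cong[OF grad_sq_eq[of E p f x], of Re] by simp
  ultimately show ?thesis
    unfolding laplacian_cmult using bochner by (simp add: algebra_simps)
qed

text \<open>Adding \<open>\<alpha>\<close> times the formula for \<open>\<Delta>|f|\<^sup>2\<close> to the lower bound for \<open>\<Delta>|\<nabla>f|\<^sup>2\<close> raises the
  coefficient of the gradient to \<open>\<alpha> + 2\<kappa> - 2\<mu>\<close>, which is positive for large \<open>\<alpha>\<close> whatever the sign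
  of \<open>\<kappa> - \<mu>\<close>.\<close>

lemma gradient_estimate_at_maximum:
  assumes ef: "eigenfunction V E p \<mu> f" and CD: "satisfies_CD V E p n \<kappa> f"
  obtains x0 where "x0 \<in> V"
    "\<And>z. z \<in> V \<Longrightarrow> grad_sq E p f z + \<alpha> * (cmod (f z))\<^sup>2 \<le> grad_sq E p f x0 + \<alpha> * (cmod (f x0))\<^sup>2"
    "(\<alpha> + 2 * \<kappa> - 2 * \<mu>) * grad_sq E p f x0 \<le> (2 * \<alpha> * \<mu> - 4 * \<mu>\<^sup>2 / n) * (cmod (f x0))\<^sup>2"
proof -
  define \<Phi> where "\<Phi> z = grad_sq E p f z + \<alpha> * (cmod (f z))\<^sup>2" for z
  define h where "h z = 2 * carre_du_champ E p f f z + of_real \<alpha> * (f z * cnj (f z))" for z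
  have h: "h z = of_real (\<Phi> z)" for z
    by (simp add: h_def \<Phi>_def grad_sq_eq flip: complex_norm_square)
  have "V \<noteq> {}"
    using ef by (auto simp: eigenfunction_def)
  then have "\<Phi> ` V \<noteq> {}" "finite (\<Phi> ` V)"
    using finite_V by auto
  then obtain x0 where x0: "x0 \<in> V" "\<Phi> x0 = Max (\<Phi> ` V)"
    by (metis Max_in imageE)
  then have max: "\<Phi> z \<le> \<Phi> x0" if "z \<in> V" for z
    using that \<open>finite (\<Phi> ` V)\<close> by simp
  have "Re (laplacian E p h x0) \<le> 0"
    using x0(1) max by (intro laplacian_nonpos_at_maximum) (auto simp: h)
  moreover have "Re (laplacian E p h x0) =
      Re (laplacian E p (\<lambda>z. 2 * carre_du_champ E p f f z) x0)
      + \<alpha> * (grad_sq E p f x0 - 2 * \<mu> * (cmod (f x0))\<^sup>2)"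
    unfolding h_def laplacian_add laplacian_cmult[of _ _ "of_real \<alpha>"]
    by (simp add: laplacian_cmod_sq_eigenfunction[OF ef x0(1)])
  ultimately have "(\<alpha> + 2 * \<kappa> - 2 * \<mu>) * grad_sq E p f x0
      \<le> (2 * \<alpha> * \<mu> - 4 * \<mu>\<^sup>2 / n) * (cmod (f x0))\<^sup>2"
    using laplacian_grad_sq_eigenfunction[OF ef CD x0(1)] by (simp add: algebra_simps)
  then show thesis
    using that[OF x0(1)] max by (auto simp: \<Phi>_def)
qed

text \<open>A weak form of the Lichnerowicz bound: at a maximum of the gradient the differential inequality
  gives \<open>2(\<kappa> - \<mu>)|\<nabla>f|\<^sup>2 \<le> 0\<close>, and this maximum is positive.\<close>

lemma CD_eigenvalue_ge_curvature:
  assumes ef: "eigenfunction V E p \<mu> f" and CD: "satisfies_CD V E p n \<kappa> f"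
    and "0 < n" "\<mu> \<noteq> 0"
  shows "\<kappa> \<le> \<mu>"
proof -
  obtain x0 where x0: "x0 \<in> V"
    "\<And>z. z \<in> V \<Longrightarrow> grad_sq E p f z \<le> grad_sq E p f x0"
    "(2 * \<kappa> - 2 * \<mu>) * grad_sq E p f x0 \<le> - (4 * \<mu>\<^sup>2 / n) * (cmod (f x0))\<^sup>2"
    using gradient_estimate_at_maximum[OF ef CD, of 0] by auto
  obtain z where "z \<in> V" "0 < grad_sq E p f z"
    using eigenfunction_grad_sq_pos[OF ef \<open>\<mu> \<noteq> 0\<close>] .
  then have "0 < grad_sq E p f x0"
    using x0(2)[of z] by simp
  moreover have "0 \<le> 4 * \<mu>\<^sup>2 / n * (cmod (f x0))\<^sup>2"
    using \<open>0 < n\<close> by simp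
  with x0(3) have "(2 * \<kappa> - 2 * \<mu>) * grad_sq E p f x0 \<le> 0"
    by linarith
  ultimately show ?thesis
    by (simp add: mult_le_0_iff)
qed

end

theorem theorem2p4:
  fixes V :: "'a set" and E :: "'a set set" and p :: "'a \<Rightarrow> 'a \<Rightarrow> real"
    and n \<kappa> \<mu> :: real and f :: "'a \<Rightarrow> complex" and x :: 'a
  assumes "weighted_graph V E p"
    and "connected_graph V E"
    and "1 < n" and "\<kappa> \<noteq> 0" and "0 < \<mu>"
    and "eigenfunction V E p \<mu> f"
    and "satisfies_CD V E p n \<kappa> f"
    and "x \<in> V"
  shows "grad_sq E p f x
    \<le> ((8 - 2 / n) * \<mu> - 4 * \<kappa>) * Max ((\<lambda>z. (cmod (f z))\<^sup>2) ` V)"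
proof -
  interpret weighted_graph V E p by fact
  note ef = \<open>eigenfunction V E p \<mu> f\<close> and CD = \<open>satisfies_CD V E p n \<kappa> f\<close>
  \<comment> \<open>This choice makes the coefficient \<open>\<alpha> + 2\<kappa> - 2\<mu>\<close> of the gradient equal to \<open>2\<mu>\<close>.\<close>
  define \<alpha> where "\<alpha> = 4 * \<mu> - 2 * \<kappa>"
  define K where "K = (8 - 2 / n) * \<mu> - 4 * \<kappa>"
  have "\<kappa> \<le> \<mu>"
    using CD_eigenvalue_ge_curvature[OF ef CD] assms by simp
  then have "0 \<le> \<alpha>"
    using \<open>0 < \<mu>\<close> by (simp add: \<alpha>_def)
  obtain x0 where x0: "x0 \<in> V"
    and max: "\<And>z. z \<in> V \<Longrightarrow>
      grad_sq E p f z + \<alpha> * (cmod (f z))\<^sup>2 \<le> grad_sq E p f x0 + \<alpha> * (cmod (f x0))\<^sup>2"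
    and at_max: "(\<alpha> + 2 * \<kappa> - 2 * \<mu>) * grad_sq E p f x0
      \<le> (2 * \<alpha> * \<mu> - 4 * \<mu>\<^sup>2 / n) * (cmod (f x0))\<^sup>2"
    using gradient_estimate_at_maximum[OF ef CD] by blast
  have "(2 * \<mu>) * grad_sq E p f x0 \<le> (2 * \<mu>) * ((\<alpha> - 2 * \<mu> / n) * (cmod (f x0))\<^sup>2)"
    using at_max by (simp add: \<alpha>_def algebra_simps power2_eq_square)
  then have at_x0: "grad_sq E p f x0 \<le> (\<alpha> - 2 * \<mu> / n) * (cmod (f x0))\<^sup>2"
    using \<open>0 < \<mu>\<close> by simp
  have bound: "grad_sq E p f z \<le> K * (cmod (f x0))\<^sup>2" if "z \<in> V" for z
  proof -
    have "grad_sq E p f z \<le> grad_sq E p f z + \<alpha> * (cmod (f z))\<^sup>2"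
      using \<open>0 \<le> \<alpha>\<close> by simp
    also have "\<dots> \<le> grad_sq E p f x0 + \<alpha> * (cmod (f x0))\<^sup>2"
      using max[OF that] .
    also have "\<dots> \<le> K * (cmod (f x0))\<^sup>2"
      using at_x0 by (simp add: K_def \<alpha>_def algebra_simps)
    finally show ?thesis .
  qed
  obtain z where "z \<in> V" "0 < grad_sq E p f z"
    using eigenfunction_grad_sq_pos[OF ef] \<open>0 < \<mu>\<close> by auto
  then have "0 < K * (cmod (f x0))\<^sup>2"
    using bound[of z] by simp
  then have "0 < K"
    by (simp add: zero_less_mult_iff)
  have "(cmod (f x0))\<^sup>2 \<le> Max ((\<lambda>z. (cmod (f z))\<^sup>2) ` V)"
    using finite_V x0 by (intro Max_ge) auto
  then have "K * (cmod (f x0))\<^sup>2 \<le> K * Max ((\<lambda>z. (cmod (f z))\<^sup>2) ` V)"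
    using \<open>0 < K\<close> by (intro mult_left_mono) auto
  then show ?thesis
    using bound[OF \<open>x \<in> V\<close>] unfolding K_def by linarith
qed

end
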